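(* Let $\mathcal{H}$ be an arbitrary complex Hilbert space (not necessarily separable) and let $T$ be a bounded linear operator on $\mathcal{H}$. If $T$ is completely normaloid and $T^n$ is normal for some positive integer $n$, then $T$ is normal.
   Context: An operator is a bounded linear transformation of a normed space into itself. An operator $A$ is normaloid if its spectral radius equals its norm, $r(A)=\|A\|$; equivalently, $\|A^k\|=\|A\|^k$ for every integer $k\ge 1$. A closed subspace $\mathcal{M}$ of $\mathcal{H}$ reduces $T$ if it is invariant for both $T$ and its adjoint $T^*$. A Hilbert-space operator $T$ is completely normaloid if the restriction $T|_{\mathcal{M}}$ is normaloid for every subspace $\mathcal{M}$ that reduces $T$ (including $\mathcal{M}=\mathcal{H}$, so $T$ itself is normaloid). An operator $T$ is normal if $T^*T=TT^*$. *)

theory Defs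
  imports "HOL-Analysis.Analysis"
begin

text \<open>Complex Hilbert spaces. The real scalar multiplication, norm, metric and completeness come
  from the superclass \<open>banach\<close>; the axioms tie them to the complex structure. The inner product is
  linear in its first argument. The unit law and the positive definiteness of the inner product
  follow from \<open>scaleR_scaleC\<close> and \<open>cinner_self\<close>.\<close>

class chilbert_space = banach +
  fixes scaleC :: "complex \<Rightarrow> 'a \<Rightarrow> 'a"  (infixr "*\<^sub>C" 75)
    and cinner :: "'a \<Rightarrow> 'a \<Rightarrow> complex"
  assumes scaleC_add_right: "c *\<^sub>C (x + y) = c *\<^sub>C x + c *\<^sub>C y"
    and scaleC_add_left: "(c + d) *\<^sub>C x = c *\<^sub>C x + d *\<^sub>C x"
    and scaleC_scaleC: "c *\<^sub>C d *\<^sub>C x = (c * d) *\<^sub>C x"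
    and scaleR_scaleC: "r *\<^sub>R x = complex_of_real r *\<^sub>C x"
    and cinner_add_left: "cinner (x + y) z = cinner x z + cinner y z"
    and cinner_scaleC_left: "cinner (c *\<^sub>C x) y = c * cinner x y"
    and cinner_commute: "cinner y x = cnj (cinner x y)"
    and cinner_self: "cinner x x = complex_of_real ((norm x)\<^sup>2)"

definition csubspace :: "'a::chilbert_space set \<Rightarrow> bool" where
  "csubspace M \<longleftrightarrow> 0 \<in> M \<and> (\<forall>x\<in>M. \<forall>y\<in>M. x + y \<in> M) \<and> (\<forall>c. \<forall>x\<in>M. c *\<^sub>C x \<in> M)"

text \<open>The notions below are relative to a subspace \<open>M\<close>: they describe the restriction of \<open>T\<close> to \<open>M\<close>
  as an operator on the space \<open>M\<close>, and depend only on the values of \<open>T\<close> on \<open>M\<close>. The case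
  \<open>M = UNIV\<close> gives the notions for the whole space.\<close>

definition bounded_operator_on :: "'a::chilbert_space set \<Rightarrow> ('a \<Rightarrow> 'a) \<Rightarrow> bool" where
  "bounded_operator_on M T \<longleftrightarrow>
     (\<forall>x\<in>M. T x \<in> M) \<and>
     (\<forall>x\<in>M. \<forall>y\<in>M. T (x + y) = T x + T y) \<and>
     (\<forall>c. \<forall>x\<in>M. T (c *\<^sub>C x) = c *\<^sub>C T x) \<and>
     (\<exists>B. \<forall>x\<in>M. norm (T x) \<le> B * norm x)"

abbreviation bounded_operator :: "('a::chilbert_space \<Rightarrow> 'a) \<Rightarrow> bool" where
  "bounded_operator T \<equiv> bounded_operator_on UNIV T"

text \<open>The same formula as for \<^const>\<open>onorm\<close>, with the supremum taken over \<open>M\<close>.\<close>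

definition onorm_on :: "'a::chilbert_space set \<Rightarrow> ('a \<Rightarrow> 'a) \<Rightarrow> real" where
  "onorm_on M T = (SUP x\<in>M. norm (T x) / norm x)"

definition spectrum_on :: "'a::chilbert_space set \<Rightarrow> ('a \<Rightarrow> 'a) \<Rightarrow> complex set" where
  "spectrum_on M T =
     {z. \<not> (\<exists>S. bounded_operator_on M S \<and>
              (\<forall>x\<in>M. S (z *\<^sub>C x - T x) = x \<and> z *\<^sub>C S x - T (S x) = x))}"

text \<open>The spectrum is empty exactly on the zero space; inserting \<open>0\<close> makes the spectral radius \<open>0\<close>
  there and changes nothing otherwise.\<close>

definition spectral_radius_on :: "'a::chilbert_space set \<Rightarrow> ('a \<Rightarrow> 'a) \<Rightarrow> real" where
  "spectral_radius_on M T = Sup (insert 0 (cmod ` spectrum_on M T))"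

definition normaloid_on :: "'a::chilbert_space set \<Rightarrow> ('a \<Rightarrow> 'a) \<Rightarrow> bool" where
  "normaloid_on M T \<longleftrightarrow> spectral_radius_on M T = onorm_on M T"

text \<open>For a bounded operator the adjoint exists by the Riesz representation theorem and is unique.\<close>

definition cadjoint :: "('a::chilbert_space \<Rightarrow> 'a) \<Rightarrow> 'a \<Rightarrow> 'a" where
  "cadjoint T = (THE S. \<forall>x y. cinner (T x) y = cinner x (S y))"

definition reduces :: "'a::chilbert_space set \<Rightarrow> ('a \<Rightarrow> 'a) \<Rightarrow> bool" where
  "reduces M T \<longleftrightarrow> csubspace M \<and> closed M \<and> T ` M \<subseteq> M \<and> cadjoint T ` M \<subseteq> M"

definition completely_normaloid :: "('a::chilbert_space \<Rightarrow> 'a) \<Rightarrow> bool" where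
  "completely_normaloid T \<longleftrightarrow> (\<forall>M. reduces M T \<longrightarrow> normaloid_on M T)"

definition normal_operator :: "('a::chilbert_space \<Rightarrow> 'a) \<Rightarrow> bool" where
  "normal_operator T \<longleftrightarrow> cadjoint T \<circ> T = T \<circ> cadjoint T"

end

theory Submission
  imports Defs
begin

text \<open>Put \<open>M\<^sub>r = {x. \<parallel>T\<^bsup>nk\<^esup> x\<parallel> \<le> r\<^bsup>nk\<^esup> \<parallel>x\<parallel> for all k}\<close>, the spectral subspace of the normal operator \<open>N = T\<^sup>n\<close> for
  the disc of radius \<open>r\<^sup>n\<close>. Since \<open>\<parallel>N\<^sup>k x\<parallel> = \<parallel>N\<^sup>*\<^sup>k x\<parallel>\<close> and \<open>T\<^sup>*\<close> commutes with \<open>N\<^sup>*\<close>, it reduces \<open>T\<close> without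
  recourse to Fuglede's theorem. As \<open>T\<close> is normaloid on \<open>M\<^sub>r\<close>, \<open>\<parallel>Tx\<parallel> \<le> r\<parallel>x\<parallel>\<close> there, whereas
  \<open>\<parallel>T\<^sup>n x\<parallel> \<ge> r\<^sup>n \<parallel>x\<parallel>\<close> for \<open>x\<close> orthogonal to \<open>M\<^sub>r\<close>. So on a thin annulus \<open>M\<^sub>b \<ominus> M\<^bsub>cb\<^esub>\<close> both \<open>T\<close> and
  \<open>T\<^sup>*\<close> are nearly \<open>b\<close> times an isometry. Splitting the space orthogonally into finitely many thin annuli and a
  remaining \<open>M\<^sub>r\<close> with small \<open>r\<close> shows that \<open>\<parallel>Tx\<parallel>\<^sup>2 - \<parallel>T\<^sup>*x\<parallel>\<^sup>2\<close> is arbitrarily small.\<close>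

subsection \<open>Geometry of complex Hilbert spaces\<close>

lemma cinner_zero_left [simp]: "cinner 0 (y::'a::chilbert_space) = 0"
  using cinner_add_left[of 0 0 y] by simp

lemma cinner_add_right: "cinner (x::'a::chilbert_space) (y + z) = cinner x y + cinner x z"
  by (metis cinner_add_left cinner_commute complex_cnj_add)

lemma cinner_zero_right [simp]: "cinner (x::'a::chilbert_space) 0 = 0"
  using cinner_add_right[of x 0 0] by simp

lemma cinner_scaleC_right: "cinner (x::'a::chilbert_space) (c *\<^sub>C y) = cnj c * cinner x y"
  by (metis cinner_scaleC_left cinner_commute complex_cnj_mult)

lemma cinner_minus_left: "cinner (- x) (y::'a::chilbert_space) = - cinner x y"
  using cinner_add_left[of x "-x" y] by (simp add: add_eq_0_iff)

lemma cinner_minus_right: "cinner x (- y::'a::chilbert_space) = - cinner x y"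
  using cinner_add_right[of x y "-y"] by (simp add: add_eq_0_iff)

lemma cinner_diff_left: "cinner (x - z) (y::'a::chilbert_space) = cinner x y - cinner z y"
  using cinner_add_left[of x "-z" y] by (simp add: cinner_minus_left)

lemma cinner_diff_right: "cinner x (y - z::'a::chilbert_space) = cinner x y - cinner x z"
  using cinner_add_right[of x y "-z"] by (simp add: cinner_minus_right)

lemma cinner_scaleR_left: "cinner (r *\<^sub>R x) (y::'a::chilbert_space) = of_real r * cinner x y"
  by (simp add: scaleR_scaleC cinner_scaleC_left)

lemma cinner_scaleR_right: "cinner x (r *\<^sub>R y::'a::chilbert_space) = of_real r * cinner x y"
  by (simp add: scaleR_scaleC cinner_scaleC_right)

lemma Re_cinner_self: "Re (cinner x (x::'a::chilbert_space)) = (norm x)\<^sup>2"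
  by (simp add: cinner_self)

lemma Re_cinner_commute: "Re (cinner y (x::'a::chilbert_space)) = Re (cinner x y)"
  by (subst cinner_commute) simp

lemma norm_add_sq:
  "(norm (x + y))\<^sup>2 = (norm x)\<^sup>2 + 2 * Re (cinner x (y::'a::chilbert_space)) + (norm y)\<^sup>2"
  unfolding Re_cinner_self[symmetric]
  using Re_cinner_commute[of x y] by (simp add: cinner_add_left cinner_add_right)

lemma parallelogram:
  "(norm (x - y))\<^sup>2 = 2 * (norm x)\<^sup>2 + 2 * (norm (y::'a::chilbert_space))\<^sup>2 - (norm (x + y))\<^sup>2"
  using norm_add_sq[of x y] norm_add_sq[of x "- y"] by (simp add: cinner_minus_right)

lemma scaleC_one [simp]: "1 *\<^sub>C (x::'a::chilbert_space) = x"
  using scaleR_scaleC[of 1 x] by simp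

lemma norm_scaleC: "norm (c *\<^sub>C (x::'a::chilbert_space)) = cmod c * norm x"
proof -
  have "complex_of_real ((norm (c *\<^sub>C x))\<^sup>2) = c * cnj c * cinner x x"
    by (simp only: cinner_self[symmetric] cinner_scaleC_left cinner_scaleC_right ac_simps)
  also have "\<dots> = complex_of_real ((cmod c * norm x)\<^sup>2)"
    using complex_norm_square[of c] by (simp add: cinner_self power_mult_distrib)
  finally have "(norm (c *\<^sub>C x))\<^sup>2 = (cmod c * norm x)\<^sup>2"
    using of_real_eq_iff by blast
  then show ?thesis
    by (simp add: power2_eq_iff_nonneg)
qed

lemma scaleC_minus_left: "(- c) *\<^sub>C (x::'a::chilbert_space) = - (c *\<^sub>C x)"
proof -
  have "0 *\<^sub>C x = 0" using norm_scaleC[of 0 x] by simp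
  then show ?thesis using scaleC_add_left[of c "-c" x] by (simp add: add_eq_0_iff)
qed

text \<open>The subtracted multiple of \<open>y\<close> is the orthogonal projection of
  \<open>x\<close> onto the line through \<open>y\<close>, so this is Pythagoras. It yields the
  Cauchy-Schwarz inequality and the orthogonality in
  \<open>closed_csubspace_decomposition\<close>.\<close>

lemma norm_diff_scaleC_projection:
  fixes x y :: "'a::chilbert_space"
  assumes "y \<noteq> 0"
  shows "(norm (x - (cinner x y / of_real ((norm y)\<^sup>2)) *\<^sub>C y))\<^sup>2
    = (norm x)\<^sup>2 - (cmod (cinner x y))\<^sup>2 / (norm y)\<^sup>2"
proof -
  define c where "c = - (cinner x y / of_real ((norm y)\<^sup>2))"
  have "x - (cinner x y / of_real ((norm y)\<^sup>2)) *\<^sub>C y = x + c *\<^sub>C y"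
    by (simp add: c_def scaleC_minus_left)
  moreover have "(norm (x + c *\<^sub>C y))\<^sup>2 = (norm x)\<^sup>2 + 2 * Re (cnj c * cinner x y) + (cmod c * norm y)\<^sup>2"
    by (simp add: norm_add_sq cinner_scaleC_right norm_scaleC)
  moreover have "cnj c * cinner x y = - of_real ((cmod (cinner x y))\<^sup>2 / (norm y)\<^sup>2)"
    unfolding c_def using complex_norm_square[of "cinner x y"] by (simp add: mult.commute)
  moreover have "(cmod c * norm y)\<^sup>2 = (cmod (cinner x y))\<^sup>2 / (norm y)\<^sup>2"
    using assms by (simp add: c_def norm_divide norm_mult power2_eq_square)
  ultimately show ?thesis by (simp only:) simp
qed

lemma cinner_norm_le: "cmod (cinner x y) \<le> norm x * norm (y::'a::chilbert_space)"
proof (cases "y = 0")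
  case False
  have "0 \<le> (norm x)\<^sup>2 - (cmod (cinner x y))\<^sup>2 / (norm y)\<^sup>2"
    using norm_diff_scaleC_projection[OF False, of x] by (metis zero_le_power2)
  then have "(cmod (cinner x y))\<^sup>2 \<le> (norm x * norm y)\<^sup>2"
    using False by (simp add: power_mult_distrib field_simps)
  then show ?thesis by (rule power2_le_imp_le) simp
qed simp

lemma Re_cinner_le: "Re (cinner x y) \<le> norm x * norm (y::'a::chilbert_space)"
  using cinner_norm_le[of x y] complex_Re_le_cmod[of "cinner x y"] by linarith

lemma cinner_left_cancel: "(\<And>z. cinner z x = cinner z y) \<Longrightarrow> x = (y::'a::chilbert_space)"
  using cinner_self[of "x - y"] by (simp add: cinner_diff_right)

lemma bounded_linear_Re_cinner: "bounded_linear (\<lambda>y. Re (cinner x (y::'a::chilbert_space)))"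
proof (rule bounded_linear_intro[where K="norm x"])
  show "norm (Re (cinner x y)) \<le> norm y * norm x" for y
    using cinner_norm_le[of x y] abs_Re_le_cmod[of "cinner x y"] by (simp add: mult.commute)
qed (auto simp: cinner_add_right cinner_scaleR_right)

lemma bounded_linear_scaleC: "bounded_linear (\<lambda>x::'a::chilbert_space. c *\<^sub>C x)"
  by (rule bounded_linear_intro[where K="cmod c"])
    (auto simp: scaleC_add_right scaleR_scaleC scaleC_scaleC norm_scaleC mult.commute)

text \<open>A substitute for the weak compactness of bounded closed convex sets.\<close>

lemma nested_convex_Inter_nonempty:
  fixes C :: "nat \<Rightarrow> 'a::chilbert_space set"
  assumes closed: "\<And>k. closed (C k)" and convex: "\<And>k. convex (C k)"
    and nonempty: "\<And>k. C k \<noteq> {}" and decr: "decseq C"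
    and bdd: "\<And>x. x \<in> C 0 \<Longrightarrow> norm x \<le> R"
  shows "(\<Inter>k. C k) \<noteq> {}"
proof -
  \<comment> \<open>These are squared distances of the sets from the origin. They increase and are
    bounded, hence converge, and almost minimal vectors will form a Cauchy sequence.\<close>
  define d where "d k = (INF x\<in>C k. (norm x)\<^sup>2)" for k
  have sub: "C j \<subseteq> C k" if "k \<le> j" for j k
    using decr that by (simp add: decseq_def)
  have d_le: "d k \<le> (norm x)\<^sup>2" if "x \<in> C k" for x k
    unfolding d_def by (rule cINF_lower[OF _ that]) (auto intro!: bdd_belowI[where m=0])
  have d_mono: "d k \<le> d j" if "k \<le> j" for j k
    unfolding d_def using sub[OF that] nonempty[of j]
    by (intro cINF_superset_mono) (auto intro!: bdd_belowI[where m=0])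
  have "d k \<le> R\<^sup>2" for k
  proof -
    obtain x where x: "x \<in> C k" using nonempty by blast
    then have "norm x \<le> R" using bdd sub[of 0 k] by auto
    then show ?thesis using d_le[OF x] power_mono[of "norm x" R 2] by simp
  qed
  then obtain D where D: "d \<longlonglongrightarrow> D" "\<And>k. d k \<le> D"
    using d_mono incseq_convergent[of d "R\<^sup>2"] unfolding incseq_def by metis
  have "\<exists>x\<in>C k. (norm x)\<^sup>2 < d k + inverse (Suc k)" for k
    unfolding d_def using nonempty[of k]
    by (intro cINF_less_iff[THEN iffD1]) (auto intro!: bdd_belowI[where m=0])
  then obtain x where x: "\<And>k. x k \<in> C k" "\<And>k. (norm (x k))\<^sup>2 < d k + inverse (Suc k)"
    by metis
  \<comment> \<open>Midpoints of vectors in \<open>C k\<close> stay in \<open>C k\<close>, so their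
    squared norm is at least \<open>d k\<close>, while \<open>x i\<close> with
    \<open>i \<ge> k\<close> has squared norm at most \<open>D + inverse (Suc k)\<close>. The
    parallelogram law turns this into \<open>e k\<close>.\<close>
  define e where "e k = 4 * (D - d k) + 4 * inverse (Suc k)" for k
  have e_lim: "e \<longlonglongrightarrow> 0"
    unfolding e_def using tendsto_add[OF tendsto_mult_left[OF tendsto_diff[OF tendsto_const D(1)], of 4 D]
      tendsto_mult_left[OF LIMSEQ_inverse_real_of_nat, of 4]] by simp
  have dist: "(norm (x i - x j))\<^sup>2 \<le> e k" if "k \<le> i" "k \<le> j" for i j k
  proof -
    have "(1/2) *\<^sub>R x i + (1/2) *\<^sub>R x j \<in> C k"
      using sub[OF that(1)] sub[OF that(2)] x(1)
      by (intro convexD[OF convex]) auto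
    then have "d k \<le> (norm ((1/2) *\<^sub>R (x i + x j)))\<^sup>2"
      using d_le by (simp add: scaleR_add_right)
    then have "4 * d k \<le> (norm (x i + x j))\<^sup>2"
      by (simp add: power_divide)
    moreover have "(norm (x i))\<^sup>2 \<le> D + inverse (Suc k)"
      using x(2)[of i] D(2)[of i] le_imp_inverse_le[of "Suc k" "Suc i"] that
      by (smt (verit) le_imp_inverse_le of_nat_0_less_iff of_nat_mono Suc_le_mono zero_less_Suc)
    moreover have "(norm (x j))\<^sup>2 \<le> D + inverse (Suc k)"
      using x(2)[of j] D(2)[of j] le_imp_inverse_le[of "Suc k" "Suc j"] that
      by (smt (verit) le_imp_inverse_le of_nat_0_less_iff of_nat_mono Suc_le_mono zero_less_Suc)
    ultimately show ?thesis
      unfolding parallelogram e_def by simp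
  qed
  have "Cauchy x"
  proof (rule metric_CauchyI)
    fix r :: real assume "r > 0"
    then have "eventually (\<lambda>k. e k < r\<^sup>2) sequentially"
      by (intro order_tendstoD(2)[OF e_lim]) simp
    then obtain k where "e k < r\<^sup>2" by (auto simp: eventually_sequentially)
    then have "dist (x i) (x j) < r" if "i \<ge> k" "j \<ge> k" for i j
      using dist[OF that] \<open>r > 0\<close> unfolding dist_norm
      by (intro power2_less_imp_less[of "norm (x i - x j)" r]) auto
    then show "\<exists>M. \<forall>m\<ge>M. \<forall>n\<ge>M. dist (x m) (x n) < r" by blast
  qed
  then obtain l where l: "x \<longlonglongrightarrow> l" using Cauchy_convergent convergent_def by blast
  have "l \<in> C k" for k
  proof (rule closed_sequentially[OF closed, of "\<lambda>i. x (i + k)"])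
    show "x (i + k) \<in> C k" for i using sub[of k "i + k"] x(1)[of "i + k"] by auto
  qed (rule LIMSEQ_ignore_initial_segment[OF l])
  then show ?thesis by blast
qed

lemma csubspace_imp_subspace: "csubspace M \<Longrightarrow> subspace M"
  by (auto simp: csubspace_def subspace_def scaleR_scaleC)

section \<open>Orthogonal projection onto closed subspaces\<close>

definition orthogonal_to :: "'a::chilbert_space set \<Rightarrow> 'a \<Rightarrow> bool" where
  "orthogonal_to M q \<longleftrightarrow> (\<forall>m\<in>M. cinner m q = 0)"

lemma orthogonal_to_flip: "orthogonal_to M q \<Longrightarrow> m \<in> M \<Longrightarrow> cinner q m = 0"
  unfolding orthogonal_to_def by (subst cinner_commute) simp

text \<open>The part \<open>q\<close> is an element of least norm in the closed affine set
  \<open>x - M\<close>, found as a common point of the nested sets of almost minimal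
  elements.\<close>

lemma closed_csubspace_decomposition:
  fixes M :: "'a::chilbert_space set"
  assumes M: "csubspace M" "closed M"
  obtains p q where "x = p + q" "p \<in> M" "orthogonal_to M q"
proof -
  define K where "K = (\<lambda>m. x - m) ` M"
  have K: "closed K" "convex K" "x \<in> K"
    using closed_translation[OF closed_negations[OF M(2)], of x]
      convex_translation[OF convex_negations[OF subspace_imp_convex[OF csubspace_imp_subspace[OF M(1)]]], of x] M(1)
    by (auto simp: K_def image_image csubspace_def image_iff intro: bexI[where x=0])
  define d where "d = (INF y\<in>K. norm y)"
  have d_le: "d \<le> norm y" if "y \<in> K" for y
    unfolding d_def by (rule cINF_lower[OF _ that]) (auto intro!: bdd_belowI[where m=0])
  define C where "C k = K \<inter> cball 0 (d + inverse (Suc k))" for k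
  have "\<exists>y\<in>K. norm y < d + inverse (Suc k)" for k
    unfolding d_def using K(3)
    by (intro cINF_less_iff[THEN iffD1]) (auto intro!: bdd_belowI[where m=0])
  then have ne: "C k \<noteq> {}" for k by (force simp: C_def dest: less_imp_le)
  have "(\<Inter>k. C k) \<noteq> {}"
  proof (rule nested_convex_Inter_nonempty[OF _ _ ne, where R="d + 1"])
    show "decseq C"
      unfolding decseq_Suc_iff C_def
      by (auto elim!: order_trans simp: le_imp_inverse_le)
  qed (auto simp: C_def intro: closed_Int K convex_Int)
  then obtain q where q: "\<And>k. q \<in> C k" by blast
  have qK: "q \<in> K" using q[of 0] by (simp add: C_def)
  have "norm q \<le> d + inverse (real (Suc k))" for k using q[of k] by (simp add: C_def)
  then have qd: "norm q \<le> d"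
    by (intro LIMSEQ_le_const[OF tendsto_add[OF tendsto_const LIMSEQ_inverse_real_of_nat, of d, simplified]]) auto
  obtain p where p: "p \<in> M" "q = x - p" using qK by (auto simp: K_def)
  have "cinner m q = 0" if m: "m \<in> M" for m
  proof (cases "m = 0")
    case False
    \<comment> \<open>Removing from \<open>q\<close> its component along \<open>m\<close> gives
      another point of \<open>K\<close>; by minimality this cannot lower the norm, so the component
      vanishes.\<close>
    let ?c = "cinner q m / of_real ((norm m)\<^sup>2)"
    have "p + ?c *\<^sub>C m \<in> M" using M(1) p(1) m by (simp add: csubspace_def)
    then have "q - ?c *\<^sub>C m \<in> K" by (auto simp: K_def p(2) image_iff intro!: bexI[where x="p + ?c *\<^sub>C m"])
    from d_le[OF this] qd have "(norm q)\<^sup>2 \<le> (norm (q - ?c *\<^sub>C m))\<^sup>2"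
      by (intro power_mono) auto
    then have "(cmod (cinner q m))\<^sup>2 / (norm m)\<^sup>2 \<le> 0"
      unfolding norm_diff_scaleC_projection[OF False] by simp
    then have "cinner q m = 0" using False by (simp add: divide_le_0_iff)
    then show ?thesis by (subst cinner_commute) simp
  qed simp
  then show ?thesis using that[of p q] p by (auto simp: orthogonal_to_def)
qed

subsection \<open>Adjoints\<close>

lemma bounded_operator_iff:
  "bounded_operator T \<longleftrightarrow> bounded_linear T \<and> (\<forall>c x. T (c *\<^sub>C x) = c *\<^sub>C T x)"
proof
  assume T: "bounded_operator T"
  then obtain B where "\<And>x. norm (T x) \<le> norm x * B"
    by (auto simp: bounded_operator_on_def mult.commute)
  then have "bounded_linear T"
    using T by (intro bounded_linear_intro[where K=B]) (auto simp: bounded_operator_on_def scaleR_scaleC)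
  then show "bounded_linear T \<and> (\<forall>c x. T (c *\<^sub>C x) = c *\<^sub>C T x)"
    using T by (auto simp: bounded_operator_on_def)
next
  assume T: "bounded_linear T \<and> (\<forall>c x. T (c *\<^sub>C x) = c *\<^sub>C T x)"
  then show "bounded_operator T"
    using bounded_linear.bounded[of T] linear_add[OF bounded_linear.linear, of T]
    by (auto simp: bounded_operator_on_def mult.commute)
qed

lemma bounded_operator_apply_scaleR: "bounded_operator T \<Longrightarrow> T (r *\<^sub>R x) = r *\<^sub>R T x"
  by (simp add: bounded_operator_on_def scaleR_scaleC)

lemma bounded_operator_comp: "bounded_operator S \<Longrightarrow> bounded_operator T \<Longrightarrow> bounded_operator (\<lambda>x. S (T x))"
  by (auto simp: bounded_operator_iff intro: bounded_linear_compose)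

lemma bounded_operator_add: "bounded_operator S \<Longrightarrow> bounded_operator T \<Longrightarrow> bounded_operator (\<lambda>x. S x + T x)"
  by (auto simp: bounded_operator_iff scaleC_add_right intro: bounded_linear_add)

lemma bounded_operator_scaleR: "bounded_operator T \<Longrightarrow> bounded_operator (\<lambda>x. r *\<^sub>R T x)"
  by (auto simp: bounded_operator_iff scaleR_scaleC scaleC_scaleC mult.commute
      intro: bounded_linear_compose[OF bounded_linear_scaleC])

lemma bounded_operator_funpow: "bounded_operator T \<Longrightarrow> bounded_operator (T ^^ k)"
proof (induction k)
  case 0
  then show ?case by (simp add: bounded_operator_iff id_def bounded_linear_ident)
next
  case (Suc k)
  then show ?case using bounded_operator_comp[of T "T ^^ k"] by (simp add: comp_def)
qed

text \<open>The kernel of \<open>f\<close> is closed, so some \<open>q\<close> orthogonal to it has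
  \<open>f q \<noteq> 0\<close>; a multiple of \<open>q\<close> represents \<open>f\<close>.\<close>

lemma riesz_representation:
  fixes f :: "'a::chilbert_space \<Rightarrow> complex"
  assumes f: "bounded_linear f" and fC: "\<And>c x. f (c *\<^sub>C x) = c * f x"
  shows "\<exists>w. \<forall>x. f x = cinner x w"
proof (cases "\<forall>x. f x = 0")
  case True
  then show ?thesis by (auto intro: exI[where x=0])
next
  case False
  then obtain u where u: "f u \<noteq> 0" by blast
  interpret f: bounded_linear f by fact
  define M where "M = {x. f x = 0}"
  have "csubspace M" by (auto simp: M_def csubspace_def f.zero f.add fC)
  moreover have "closed M"
    unfolding M_def by (intro closed_Collect_eq linear_continuous_on f continuous_on_const)
  ultimately obtain p q where pq: "u = p + q" "p \<in> M" "orthogonal_to M q"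
    by (rule closed_csubspace_decomposition)
  have fq: "f q \<noteq> 0" using u pq by (auto simp: M_def f.add)
  have q: "q \<noteq> 0" using fq f.zero by auto
  have "f x = cinner x ((cnj (f q) / of_real ((norm q)\<^sup>2)) *\<^sub>C q)" for x
  proof -
    \<comment> \<open>This combination lies in the kernel; pairing it with \<open>q\<close> can be
      solved for \<open>f x\<close>.\<close>
    have "f q *\<^sub>C x + (- f x) *\<^sub>C q \<in> M" by (simp add: M_def f.add fC)
    then have "cinner (f q *\<^sub>C x + (- f x) *\<^sub>C q) q = 0" using pq(3) by (auto simp: orthogonal_to_def)
    then have "f q * cinner x q = f x * of_real ((norm q)\<^sup>2)"
      by (simp add: cinner_add_left cinner_scaleC_left cinner_self)
    then show ?thesis using q by (simp add: cinner_scaleC_right field_simps)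
  qed
  then show ?thesis by blast
qed

lemma funpow_commute_apply: "(\<And>x. U (A x) = A (U x)) \<Longrightarrow> U ((A ^^ k) x) = (A ^^ k) (U x)"
  by (induction k) auto

text \<open>A relation replaces the description operator of \<open>cadjoint\<close>: it is
  symmetric, passes to powers and real multiples, and determines its second operator.\<close>

definition adjoint_pair :: "('a::chilbert_space \<Rightarrow> 'a) \<Rightarrow> ('a \<Rightarrow> 'a) \<Rightarrow> bool" where
  "adjoint_pair A A' \<longleftrightarrow> bounded_operator A \<and> bounded_operator A' \<and> (\<forall>x y. cinner (A x) y = cinner x (A' y))"

lemma adjoint_pair_sym: "adjoint_pair A A' \<Longrightarrow> adjoint_pair A' A"
  unfolding adjoint_pair_def by (metis cinner_commute)

lemma cadjoint_unique:
  assumes "adjoint_pair A A'"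
  shows "cadjoint A = A'"
  unfolding cadjoint_def
proof (rule the_equality)
  show "\<forall>x y. cinner (A x) y = cinner x (A' y)" using assms by (simp add: adjoint_pair_def)
  fix S assume "\<forall>x y. cinner (A x) y = cinner x (S y)"
  then have "S y = A' y" for y
    using assms by (intro cinner_left_cancel) (simp add: adjoint_pair_def)
  then show "S = A'" by (rule ext)
qed

text \<open>For each \<open>y\<close> the functional sending \<open>x\<close> to
  \<open>cinner (T x) y\<close> has a Riesz vector \<open>S y\<close>; nondegeneracy of the inner
  product makes \<open>S\<close> linear.\<close>

lemma adjoint_pair_cadjoint:
  fixes T :: "'a::chilbert_space \<Rightarrow> 'a"
  assumes T: "bounded_operator T"
  shows "adjoint_pair T (cadjoint T)"
proof -
  interpret T: bounded_linear T using T by (simp add: bounded_operator_iff)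
  obtain B where B: "\<And>x. norm (T x) \<le> norm x * B" using T.bounded by blast
  have "\<exists>w. \<forall>x. cinner (T x) y = cinner x w" for y
  proof (rule riesz_representation)
    show "bounded_linear (\<lambda>x. cinner (T x) y)"
    proof (rule bounded_linear_intro[where K="B * norm y"])
      show "norm (cinner (T x) y) \<le> norm x * (B * norm y)" for x
        using cinner_norm_le[of "T x" y] mult_right_mono[OF B[of x], of "norm y"] by (simp add: mult.assoc)
    qed (auto simp: T.add T.scaleR cinner_add_left cinner_scaleR_left scaleR_conv_of_real)
    show "cinner (T (c *\<^sub>C x)) y = c * cinner (T x) y" for c x
      using T by (simp add: bounded_operator_iff cinner_scaleC_left)
  qed
  then obtain S where S: "\<And>x y. cinner (T x) y = cinner x (S y)" by metis
  have "bounded_operator S"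
    unfolding bounded_operator_on_def
  proof (intro conjI ballI allI)
    show "S (x + y) = S x + S y" for x y
      by (rule cinner_left_cancel) (simp add: S[symmetric] cinner_add_right)
    show "S (c *\<^sub>C x) = c *\<^sub>C S x" for c x
      by (rule cinner_left_cancel) (simp add: S[symmetric] cinner_scaleC_right)
    have "norm (S y) \<le> B * norm y" for y
    proof (cases "S y = 0")
      case True
      \<comment> \<open>\<open>B\<close> is not known to be nonnegative, but the bound on
        \<open>T y\<close> forces this as soon as \<open>y\<close> is nonzero.\<close>
      moreover have "0 \<le> B * norm y"
      proof (cases "y = 0")
        case False
        then show ?thesis using order_trans[OF norm_ge_zero B[of y]] by (simp add: mult.commute)
      qed simp
      ultimately show ?thesis by simp
    next
      case False
      have "(norm (S y))\<^sup>2 = Re (cinner (T (S y)) y)" by (simp add: S cinner_self)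
      also have "\<dots> \<le> norm (S y) * (B * norm y)"
        using Re_cinner_le[of "T (S y)" y] mult_right_mono[OF B[of "S y"], of "norm y"] by (simp add: mult.assoc)
      finally show ?thesis using False by (simp add: power2_eq_square)
    qed
    then show "\<exists>B. \<forall>x\<in>UNIV. norm (S x) \<le> B * norm x" by blast
  qed simp
  then have "adjoint_pair T S" using T S by (simp add: adjoint_pair_def)
  then show ?thesis by (simp add: cadjoint_unique)
qed

lemma adjoint_pair_funpow:
  assumes A: "adjoint_pair A A'"
  shows "adjoint_pair (A ^^ k) (A' ^^ k)"
proof -
  have "cinner ((A ^^ k) x) y = cinner x ((A' ^^ k) y)" for x y
    using A by (induction k arbitrary: x y) (auto simp: adjoint_pair_def funpow_swap1)
  then show ?thesis using A by (simp add: adjoint_pair_def bounded_operator_funpow)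
qed

lemma adjoint_pair_scaleR: "adjoint_pair A A' \<Longrightarrow> adjoint_pair (\<lambda>x. r *\<^sub>R A x) (\<lambda>x. r *\<^sub>R A' x)"
  by (auto simp: adjoint_pair_def bounded_operator_scaleR cinner_scaleR_left cinner_scaleR_right)

section \<open>Convex real sequences\<close>

lemma convex_seq_diff_mono:
  fixes b :: "nat \<Rightarrow> real"
  assumes "\<And>j. 2 * b (Suc j) \<le> b j + b (Suc (Suc j))" "i \<le> j"
  shows "b (Suc i) - b i \<le> b (Suc j) - b j"
  by (rule lift_Suc_mono_le[where f="\<lambda>i. b (Suc i) - b i", OF _ assms(2)])
    (use assms(1) in \<open>simp add: algebra_simps\<close>)

text \<open>If the sequence rises at \<open>j\<close> it keeps rising up to \<open>k\<close>; if it
  falls at \<open>j\<close> it has been falling since 0.\<close>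

lemma convex_seq_le_max:
  fixes b :: "nat \<Rightarrow> real"
  assumes b: "\<And>j. 2 * b (Suc j) \<le> b j + b (Suc (Suc j))" and "j \<le> k"
  shows "b j \<le> max (b 0) (b k)"
proof (cases "b j \<le> b (Suc j)")
  case True
  then have "b i \<le> b (Suc i)" if "j \<le> i" for i using convex_seq_diff_mono[of b, OF b that] by simp
  with \<open>j \<le> k\<close> have "b j \<le> b k" by (induction rule: dec_induct) (auto intro: order_trans)
  then show ?thesis by simp
next
  case False
  then have "b (Suc i) \<le> b i" if "i \<le> j" for i using convex_seq_diff_mono[of b, OF b that] by simp
  then have "i \<le> j \<Longrightarrow> b i \<le> b 0" for i by (induction i) (auto, meson Suc_leD order_trans)
  then show ?thesis by (simp add: max.coboundedI1)
qed

text \<open>A single increase \<open>d\<close> would be repeated at every later step, and this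
  linear growth would exceed \<open>C\<close>.\<close>

lemma convex_seq_bounded_imp_decreasing:
  fixes b :: "nat \<Rightarrow> real"
  assumes b: "\<And>j. 2 * b (Suc j) \<le> b j + b (Suc (Suc j))" and C: "\<And>j. b j \<le> C"
  shows "b j \<le> b 0"
proof (rule ccontr)
  assume "\<not> b j \<le> b 0"
  then have "\<not> decseq b" by (auto simp: decseq_def)
  then obtain i where i: "b i < b (Suc i)" by (auto simp: decseq_Suc_iff not_le)
  define d where "d = b (Suc i) - b i"
  have "b i + m * d \<le> b (i + m)" for m
  proof (induction m)
    case (Suc m)
    then show ?case using convex_seq_diff_mono[of b, OF b, of i "i + m"] by (simp add: d_def algebra_simps)
  qed simp
  then have "m * d \<le> C - b i" for m :: nat using C[of "i + m"] by (smt (verit))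
  moreover have "d > 0" using i by (simp add: d_def)
  ultimately show False using reals_Archimedean3[of d] by (metis linorder_not_less)
qed

section \<open>Normal operators and the norms along their orbits\<close>

locale normal_pair =
  fixes A A' :: "'a::chilbert_space \<Rightarrow> 'a"
  assumes pair: "adjoint_pair A A'" and commute: "A (A' x) = A' (A x)"
begin

lemma bounded_operator: "bounded_operator A"
  using pair by (simp add: adjoint_pair_def)

sublocale bounded_linear A
  using bounded_operator by (simp add: bounded_operator_iff)

lemma adjoint: "cinner (A x) y = cinner x (A' y)"
  using pair by (simp add: adjoint_pair_def)

lemma norm_adjoint: "norm (A' x) = norm (A x)"
proof -
  have "cinner (A' x) (A' x) = cinner (A x) (A x)"
    by (metis adjoint commute cinner_commute)
  then have "(norm (A' x))\<^sup>2 = (norm (A x))\<^sup>2"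
    by (metis Re_cinner_self)
  then show ?thesis by (simp add: power2_eq_iff_nonneg)
qed

lemma normal_pair_funpow: "normal_pair (A ^^ k) (A' ^^ k)"
proof
  have "A' ((A ^^ k) x) = (A ^^ k) (A' x)" for x
    by (rule funpow_commute_apply) (rule commute[symmetric])
  then show "(A ^^ k) ((A' ^^ k) x) = (A' ^^ k) ((A ^^ k) x)" for x
    by (intro funpow_commute_apply) (rule sym)
qed (rule adjoint_pair_funpow[OF pair])

text \<open>Cauchy-Schwarz applied to \<open>cinner z (A' (A z))\<close>, with
  \<open>norm (A' (A z)) = norm (A (A z))\<close> by normality, makes orbit norms log-convex; the
  inequality of arithmetic and geometric means weakens this to convexity.\<close>

lemma convex_norm_funpow:
  "2 * norm ((A ^^ Suc j) x) \<le> norm ((A ^^ j) x) + norm ((A ^^ Suc (Suc j)) x)"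
proof -
  let ?z = "(A ^^ j) x"
  have "(norm (A ?z))\<^sup>2 = Re (cinner ?z (A' (A ?z)))" by (simp add: adjoint[symmetric] cinner_self)
  also have "\<dots> \<le> norm ?z * norm (A (A ?z))" using Re_cinner_le[of ?z "A' (A ?z)"] by (simp add: norm_adjoint)
  finally have "(2 * norm (A ?z))\<^sup>2 \<le> 4 * (norm ?z * norm (A (A ?z)))" by simp
  also have "\<dots> \<le> (norm ?z + norm (A (A ?z)))\<^sup>2"
    using zero_le_power2[of "norm ?z - norm (A (A ?z))"] by (simp add: power2_eq_square algebra_simps)
  finally have "2 * norm (A ?z) \<le> norm ?z + norm (A (A ?z))" by (rule power2_le_imp_le) simp
  then show ?thesis by simp
qed

end

subsection \<open>Spectral subspaces of a normal operator\<close>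

text \<open>For a normal operator this is the spectral subspace of the closed unit disc, described
  through orbits.\<close>

definition power_contractive :: "('a::real_normed_vector \<Rightarrow> 'a) \<Rightarrow> 'a set" where
  "power_contractive A = {x. \<forall>k. norm ((A ^^ k) x) \<le> norm x}"

text \<open>The operator \<open>1 + B' B\<close> is bounded below by 1, so its range is closed; a
  vector \<open>q\<close> orthogonal to the range satisfies \<open>cinner (S q) q = 0\<close>, which
  forces \<open>q = 0\<close>.\<close>

lemma solve_id_plus_adjoint_comp:
  assumes "adjoint_pair B B'"
  obtains y where "x = y + B' (B y)"
proof -
  define S where "S y = y + B' (B y)" for y
  have "bounded_operator S"
    using assms bounded_operator_add[of "\<lambda>x. x" "\<lambda>x. B' (B x)"] bounded_operator_comp[of B' B]
    by (auto simp: S_def[abs_def] adjoint_pair_def bounded_operator_iff bounded_linear_ident)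
  then interpret S: bounded_linear S by (simp add: bounded_operator_iff)
  have "cinner (B' (B q)) q = cinner (B q) (B q)" for q
    using adjoint_pair_sym[OF assms] by (simp add: adjoint_pair_def)
  then have S_self: "Re (cinner (S q) q) = (norm q)\<^sup>2 + (norm (B q))\<^sup>2" for q
    by (simp add: S_def cinner_add_left cinner_self)
  have "1 * norm q \<le> norm (S q)" for q
  proof (cases "q = 0")
    case False
    have "norm q * norm q \<le> norm (S q) * norm q"
      using S_self[of q] Re_cinner_le[of "S q" q] zero_le_power2[of "norm (B q)"]
      unfolding power2_eq_square by linarith
    then show ?thesis using False by simp
  qed simp
  then have "complete (range S)"
    by (intro complete_isometric_image[OF _ subspace_UNIV S.bounded_linear_axioms _ complete_UNIV, of 1]) auto
  then have "closed (range S)" by (rule complete_imp_closed)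
  moreover have "csubspace (range S)"
    unfolding csubspace_def
  proof (intro conjI ballI allI)
    show "0 \<in> range S" by (rule range_eqI[of _ _ 0]) (simp add: S.zero)
    show "u + v \<in> range S" if "u \<in> range S" "v \<in> range S" for u v
      using that by (auto simp: S.add[symmetric])
    show "c *\<^sub>C u \<in> range S" if "u \<in> range S" for c u
      using that \<open>bounded_operator S\<close> by (auto simp: bounded_operator_on_def) (metis rangeI)
  qed
  ultimately obtain p q where pq: "x = p + q" "p \<in> range S" "orthogonal_to (range S) q"
    using closed_csubspace_decomposition[of "range S" x] by metis
  then have "cinner (S q) q = 0" by (auto simp: orthogonal_to_def)
  then have "q = 0" using S_self[of q] by (simp add: add_nonneg_eq_0_iff)
  then show ?thesis using pq that by (auto simp: S_def)
qed

context normal_pair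
begin

lemma bounded_linear_funpow: "bounded_linear (A ^^ k)"
  using bounded_operator_funpow[OF bounded_operator] by (simp add: bounded_operator_iff)

lemma norm_funpow_adjoint: "norm ((A' ^^ k) x) = norm ((A ^^ k) x)"
  by (rule normal_pair.norm_adjoint[OF normal_pair_funpow])

text \<open>Orbit norms form a convex sequence, so any uniform bound improves to the bound by the
  initial norm. Closure under sums and under commuting operators then follows from crude
  estimates.\<close>

lemma power_contractiveI:
  assumes "\<And>k. norm ((A ^^ k) x) \<le> C"
  shows "x \<in> power_contractive A"
  using convex_seq_bounded_imp_decreasing[of "\<lambda>k. norm ((A ^^ k) x)", OF convex_norm_funpow assms]
  by (simp add: power_contractive_def)

lemma csubspace_power_contractive: "csubspace (power_contractive A)"
  unfolding csubspace_def
proof (intro conjI ballI allI)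
  show "0 \<in> power_contractive A"
    using linear_0[OF bounded_linear.linear[OF bounded_linear_funpow]] by (simp add: power_contractive_def)
  fix x assume x: "x \<in> power_contractive A"
  show "x + y \<in> power_contractive A" if "y \<in> power_contractive A" for y
  proof (rule power_contractiveI)
    show "norm ((A ^^ k) (x + y)) \<le> norm x + norm y" for k
      using x that unfolding linear_add[OF bounded_linear.linear[OF bounded_linear_funpow]]
      by (auto simp: power_contractive_def intro: norm_triangle_mono)
  qed
  show "c *\<^sub>C x \<in> power_contractive A" for c
    using x bounded_operator_funpow[OF bounded_operator]
    by (auto simp: power_contractive_def bounded_operator_iff norm_scaleC intro: mult_left_mono)
qed

lemma closed_power_contractive: "closed (power_contractive A)"
  unfolding power_contractive_def
  by (intro closed_Collect_all closed_Collect_le continuous_intros linear_continuous_on bounded_linear_funpow)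

text \<open>Applying \<open>U\<close> enlarges orbit norms by at most a constant factor. The orbit
  under \<open>A'\<close> serves as well as that under \<open>A\<close>, because their norms agree;
  this second option is what handles the adjoint of \<open>T\<close> later.\<close>

lemma power_contractive_invariant:
  assumes U: "bounded_linear U" and comm: "(\<forall>x. U (A x) = A (U x)) \<or> (\<forall>x. U (A' x) = A' (U x))"
    and x: "x \<in> power_contractive A"
  shows "U x \<in> power_contractive A"
proof -
  obtain B where B: "B > 0" "\<And>x. norm (U x) \<le> norm x * B" using bounded_linear.pos_bounded[OF U] by blast
  show ?thesis
  proof (rule power_contractiveI)
    fix k
    from comm have "norm ((A ^^ k) (U x)) \<le> norm ((A ^^ k) x) * B"
    proof
      assume "\<forall>x. U (A x) = A (U x)"
      then show ?thesis using B(2)[of "(A ^^ k) x"] by (simp add: funpow_commute_apply)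
    next
      assume "\<forall>x. U (A' x) = A' (U x)"
      then have "U ((A' ^^ k) x) = (A' ^^ k) (U x)" by (simp add: funpow_commute_apply)
      then show ?thesis using B(2)[of "(A' ^^ k) x"] by (simp add: norm_funpow_adjoint)
    qed
    also have "\<dots> \<le> norm x * B" using x B(1) by (simp add: power_contractive_def)
    finally show "norm ((A ^^ k) (U x)) \<le> norm x * B" .
  qed
qed

text \<open>The vector \<open>y\<close> is the resolvent \<open>(1 + (A\<^sup>k)\<^sup>* A\<^sup>k)\<^sup>-\<^sup>1 x\<close>; a limit of these vectors
  would be power contractive, hence orthogonal to \<open>x\<close>.\<close>

lemma resolvent_small_if_orthogonal:
  assumes x: "orthogonal_to (power_contractive A) x" and "e > 0"
  obtains k y where "x = y + (A' ^^ k) ((A ^^ k) y)" "norm y < e" "norm ((A ^^ k) y) < e"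
proof -
  have "\<exists>y. x = y + (A' ^^ k) ((A ^^ k) y)" for k
    using solve_id_plus_adjoint_comp[OF adjoint_pair_funpow[OF pair]] by metis
  then obtain y where y: "\<And>k. x = y k + (A' ^^ k) ((A ^^ k) (y k))" by metis
  \<comment> \<open>Pairing the equation for \<open>x\<close> with \<open>y k\<close> makes both
    norms to be estimated appear as squares.\<close>
  have self: "Re (cinner x (y k)) = (norm (y k))\<^sup>2 + (norm ((A ^^ k) (y k)))\<^sup>2" for k
  proof -
    have "cinner ((A' ^^ k) ((A ^^ k) (y k))) (y k) = cinner ((A ^^ k) (y k)) ((A ^^ k) (y k))"
      using adjoint_pair_sym[OF adjoint_pair_funpow[OF pair]] by (simp add: adjoint_pair_def)
    then show ?thesis by (subst y[of k]) (simp add: cinner_add_left cinner_self)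
  qed
  have ny: "norm (y k) \<le> norm x" for k
  proof (cases "y k = 0")
    case False
    have "norm (y k) * norm (y k) \<le> norm x * norm (y k)"
      using self[of k] Re_cinner_le[of x "y k"] zero_le_power2[of "norm ((A ^^ k) (y k))"]
      unfolding power2_eq_square by linarith
    then show ?thesis using False by simp
  qed simp
  have nAy: "norm ((A ^^ k) (y k)) \<le> norm x" for k
  proof (rule power2_le_imp_le)
    have "(norm ((A ^^ k) (y k)))\<^sup>2 \<le> norm x * norm (y k)"
      using self[of k] Re_cinner_le[of x "y k"] zero_le_power2[of "norm (y k)"] by linarith
    also have "\<dots> \<le> norm x * norm x" by (intro mult_left_mono ny) simp
    finally show "(norm ((A ^^ k) (y k)))\<^sup>2 \<le> (norm x)\<^sup>2" by (simp add: power2_eq_square)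
  qed simp
  \<comment> \<open>The orbit norms at times 0 and \<open>k\<close> are at most
    \<open>norm x\<close>; convexity covers the times between.\<close>
  have nAj: "norm ((A ^^ j) (y k)) \<le> norm x" if "j \<le> k" for j k
    using convex_seq_le_max[of "\<lambda>j. norm ((A ^^ j) (y k))", OF convex_norm_funpow that] ny[of k] nAy[of k]
    by simp
  have "\<exists>k. Re (cinner x (y k)) < e\<^sup>2"
  proof (rule ccontr)
    assume "\<not> ?thesis"
    then have large: "e\<^sup>2 \<le> Re (cinner x (y k))" for k by (simp add: not_less)
    \<comment> \<open>\<open>y k\<close> meets the orbit bounds for \<open>j \<le> k\<close> only,
      so the sets \<open>C k\<close> are nonempty and decreasing. A common point satisfies all the
      bounds, hence is power contractive, yet its inner product with \<open>x\<close> has positive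
      real part.\<close>
    define C where "C k = (\<Inter>j\<in>{..k}. (A ^^ j) -` cball 0 (norm x)) \<inter> {z. e\<^sup>2 \<le> Re (cinner x z)}" for k
    have "(\<Inter>k. C k) \<noteq> {}"
    proof (rule nested_convex_Inter_nonempty[where R="norm x"])
      fix k
      show "closed (C k)"
        unfolding C_def using bounded_linear_funpow
        by (intro closed_Int closed_INT ballI closed_vimage closed_cball closed_Collect_le continuous_on_const
            linear_continuous_on bounded_linear_Re_cinner)
      show "convex (C k)"
        unfolding C_def
      proof (intro convex_Int convex_INT)
        show "convex ((A ^^ j) -` cball 0 (norm x))" for j
          by (intro convex_linear_vimage bounded_linear.linear bounded_linear_funpow convex_cball)
        have "{z. e\<^sup>2 \<le> Re (cinner x z)} = (\<lambda>z. Re (cinner x z)) -` {e\<^sup>2..}" by auto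
        then show "convex {z. e\<^sup>2 \<le> Re (cinner x z)}"
          by (simp add: convex_linear_vimage bounded_linear.linear bounded_linear_Re_cinner convex_real_interval)
      qed
      have "y k \<in> C k" using nAj large by (simp add: C_def)
      then show "C k \<noteq> {}" by blast
    next
      show "decseq C" by (auto simp: decseq_def C_def)
      show "norm z \<le> norm x" if "z \<in> C 0" for z using that by (simp add: C_def)
    qed
    then obtain z where z: "\<And>k. z \<in> C k" by blast
    have "norm ((A ^^ k) z) \<le> norm x" for k using z[of k] by (auto simp: C_def)
    then have "z \<in> power_contractive A" by (rule power_contractiveI)
    then have "cinner x z = 0" by (rule orthogonal_to_flip[OF x])
    then show False using z[of 0] \<open>e > 0\<close> by (simp add: C_def)
  qed
  then obtain k where k: "Re (cinner x (y k)) < e\<^sup>2" by blast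
  have "(norm (y k))\<^sup>2 < e\<^sup>2" "(norm ((A ^^ k) (y k)))\<^sup>2 < e\<^sup>2"
    using k self[of k] zero_le_power2[of "norm (y k)"] zero_le_power2[of "norm ((A ^^ k) (y k))"] by linarith+
  then show ?thesis
    using \<open>e > 0\<close> by (intro that[OF y[of k]]) (auto intro: power2_less_imp_less)
qed

text \<open>A resolvent vector \<open>y\<close> is small at times 0 and \<open>k\<close>, while
  \<open>x - y\<close> has norm \<open>b (k + k)\<close>, which is not small. The convex sequence
  \<open>b\<close> has thus begun to rise and cannot fall at the next step, which is the passage
  from \<open>x - y\<close> to \<open>A (x - y)\<close>.\<close>

lemma norm_le_if_orthogonal:
  assumes x: "orthogonal_to (power_contractive A) x"
  shows "norm x \<le> norm (A x)"
proof (rule field_le_epsilon)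
  fix e :: real assume "e > 0"
  obtain B where B: "B > 0" "\<And>x. norm (A x) \<le> norm x * B" using pos_bounded by blast
  \<comment> \<open>Half the norm of \<open>x\<close> ensures \<open>b k < b (k + k)\<close>, since
    \<open>b (k + k)\<close> is at least \<open>norm x - norm y\<close>. The other bound absorbs the
    errors \<open>norm y\<close> and \<open>norm (A y)\<close>.\<close>
  define d where "d = min (e / (1 + B)) (norm x / 2)"
  show "norm x \<le> norm (A x) + e"
  proof (cases "x = 0")
    case False
    then have "d > 0" using \<open>e > 0\<close> B(1) by (simp add: d_def)
    obtain k y where y: "x = y + (A' ^^ k) ((A ^^ k) y)" "norm y < d" "norm ((A ^^ k) y) < d"
      by (rule resolvent_small_if_orthogonal[OF x \<open>d > 0\<close>])
    define b where "b j = norm ((A ^^ j) y)" for j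
    have convex: "2 * b (Suc j) \<le> b j + b (Suc (Suc j))" for j
      unfolding b_def by (rule convex_norm_funpow)
    have nb: "norm ((A' ^^ k) ((A ^^ k) z)) = norm ((A ^^ (k + k)) z)" for z
      by (simp add: norm_funpow_adjoint funpow_add)
    have x_le: "norm x \<le> norm y + b (k + k)"
      using norm_triangle_ineq[of y "(A' ^^ k) ((A ^^ k) y)"] y(1) by (simp add: b_def nb)
    have "b k < b (k + k)" using x_le y(2,3) by (simp add: b_def d_def)
    \<comment> \<open>Convexity from \<open>k\<close> to \<open>Suc (k + k)\<close>: the value at
      \<open>k + k\<close> is at most the larger end value, and that cannot be the left one.\<close>
    have grow: "b (k + k) \<le> b (Suc (k + k))"
      using convex_seq_le_max[of "\<lambda>j. b (j + k)" k "Suc k"] convex \<open>b k < b (k + k)\<close> by simp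
    have "A ((A' ^^ k) ((A ^^ k) y)) = (A' ^^ k) ((A ^^ k) (A y))"
      by (metis funpow_commute_apply commute funpow_swap1)
    then have "norm (A ((A' ^^ k) ((A ^^ k) y))) = b (Suc (k + k))"
      by (simp add: nb b_def funpow_swap1)
    moreover have "A ((A' ^^ k) ((A ^^ k) y)) = A x - A y"
      using y(1) by (metis add add_diff_cancel_left')
    ultimately have "b (Suc (k + k)) \<le> norm (A x) + norm (A y)"
      by (metis norm_triangle_ineq4)
    then have "norm x \<le> norm (A x) + norm y * (1 + B)"
      using x_le grow B(2)[of y] by (simp add: algebra_simps)
    also have "norm y * (1 + B) \<le> d * (1 + B)"
      using y(2) B(1) by (intro mult_right_mono) auto
    also have "\<dots> \<le> (e / (1 + B)) * (1 + B)"
      using B(1) by (intro mult_right_mono) (auto simp: d_def)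
    also have "\<dots> = e" using B(1) by simp
    finally show ?thesis by simp
  qed (use \<open>e > 0\<close> in simp)
qed

end

subsection \<open>Normaloid restrictions\<close>

lemma funpow_closed: "T ` M \<subseteq> M \<Longrightarrow> x \<in> M \<Longrightarrow> (T ^^ k) x \<in> M"
  by (induction k) auto

lemma norm_funpow_le:
  fixes T :: "'a::real_normed_vector \<Rightarrow> 'a"
  assumes "T ` M \<subseteq> M" "\<And>x. x \<in> M \<Longrightarrow> norm (T x) \<le> b * norm x" "0 \<le> b" "x \<in> M"
  shows "norm ((T ^^ k) x) \<le> b ^ k * norm x"
proof (induction k)
  case (Suc k)
  have "norm ((T ^^ Suc k) x) \<le> b * norm ((T ^^ k) x)"
    using assms(2)[OF funpow_closed[OF assms(1,4), of k]] by simp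
  also have "\<dots> \<le> b * (b ^ k * norm x)" using Suc assms(3) by (rule mult_left_mono)
  finally show ?case by (simp add: mult.assoc)
qed simp

text \<open>Powers are taken in blocks of \<open>n\<close>, each contributing a factor
  \<open>r ^ n\<close>; the fewer than \<open>n\<close> remaining steps are estimated crudely and
  absorbed by the constant.\<close>

lemma power_bound_imp_growth_bound:
  fixes T :: "'a::chilbert_space \<Rightarrow> 'a"
  assumes T: "bounded_operator T" and inv: "T ` M \<subseteq> M" and "n \<ge> 1" and "r > 0"
    and pow: "\<And>x. x \<in> M \<Longrightarrow> norm ((T ^^ n) x) \<le> r ^ n * norm x"
  obtains C where "C \<ge> 0" "\<And>k x. x \<in> M \<Longrightarrow> norm ((T ^^ k) x) \<le> C * r ^ k * norm x"
proof -
  obtain B where B: "B > 0" "\<And>x. norm (T x) \<le> norm x * B"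
    using bounded_linear.pos_bounded[of T] T by (auto simp: bounded_operator_iff)
  \<comment> \<open>\<open>B / r\<close> compares a crude step with a step of factor
    \<open>r\<close>; the maximum with 1 gives \<open>D ^ k \<le> D ^ n\<close> for
    \<open>k < n\<close>.\<close>
  define D where "D = max 1 (B / r)"
  have "norm ((T ^^ k) x) \<le> D ^ n * r ^ k * norm x" if "x \<in> M" for k x
  proof (induction k rule: less_induct)
    case (less k)
    show ?case
    proof (cases "k < n")
      case True
      have "norm ((T ^^ k) x) \<le> B ^ k * norm x"
        using B by (intro norm_funpow_le[where M=UNIV]) (auto simp: mult.commute)
      also have "B ^ k * norm x \<le> (D ^ n * r ^ k) * norm x"
      proof (rule mult_right_mono)
        have "B ^ k = (B / r) ^ k * r ^ k" using \<open>r > 0\<close> by (simp add: power_divide)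
        also have "\<dots> \<le> D ^ k * r ^ k"
          using B(1) \<open>r > 0\<close> by (intro mult_right_mono power_mono) (auto simp: D_def)
        also have "\<dots> \<le> D ^ n * r ^ k"
          using True \<open>r > 0\<close> by (intro mult_right_mono power_increasing) (auto simp: D_def)
        finally show "B ^ k \<le> D ^ n * r ^ k" .
      qed simp
      finally show ?thesis .
    next
      case False
      then have k: "k = n + (k - n)" by simp
      have "norm ((T ^^ k) x) \<le> r ^ n * norm ((T ^^ (k - n)) x)"
        using pow[OF funpow_closed[OF inv that, of "k - n"]]
        by (subst k) (simp add: funpow_add del: le_add_diff_inverse le_add_diff_inverse2)
      also have "\<dots> \<le> r ^ n * (D ^ n * r ^ (k - n) * norm x)"
        using less[of "k - n"] False \<open>n \<ge> 1\<close> \<open>r > 0\<close> by (intro mult_left_mono) auto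
      also have "\<dots> = D ^ n * r ^ (n + (k - n)) * norm x"
        by (simp only: power_add ac_simps)
      finally show ?thesis using k by simp
    qed
  qed
  then show ?thesis by (intro that[of "D ^ n"]) (auto simp: D_def)
qed

text \<open>Outside the disc of radius \<open>r\<close> the Neumann series, with terms
  \<open>s x k\<close>, converges geometrically. Its sum stays in the closed subspace
  \<open>M\<close> and inverts \<open>z - T\<close> there from both sides.\<close>

lemma growth_bound_notin_spectrum_on:
  fixes T :: "'a::chilbert_space \<Rightarrow> 'a"
  assumes T: "bounded_operator T" and M: "csubspace M" "closed M" and inv: "T ` M \<subseteq> M"
    and "r > 0" and growth: "\<And>k x. x \<in> M \<Longrightarrow> norm ((T ^^ k) x) \<le> C * r ^ k * norm x"
    and z: "cmod z > r"
  shows "z \<notin> spectrum_on M T"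
proof -
  interpret T: bounded_linear T using T by (simp add: bounded_operator_iff)
  have TC: "T (c *\<^sub>C x) = c *\<^sub>C T x" for c x using T by (simp add: bounded_operator_iff)
  have Tk: "bounded_operator (T ^^ k)" for k by (rule bounded_operator_funpow[OF T])
  have "z \<noteq> 0" using z \<open>r > 0\<close> by auto
  define s where "s x k = (inverse z ^ Suc k) *\<^sub>C (T ^^ k) x" for x k
  define S where "S x = suminf (s x)" for x
  define q where "q = r / cmod z"
  have q: "0 \<le> q" "q < 1" using z \<open>r > 0\<close> by (auto simp: q_def divide_less_eq)
  have s_le: "norm (s x k) \<le> (C / cmod z * norm x) * q ^ k" if "x \<in> M" for x k
  proof -
    have "norm (s x k) = inverse (cmod z) ^ Suc k * norm ((T ^^ k) x)"
      by (simp only: s_def norm_scaleC norm_power norm_inverse)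
    also have "\<dots> \<le> inverse (cmod z) ^ Suc k * (C * r ^ k * norm x)"
      by (intro mult_left_mono growth that) simp
    also have "\<dots> = (C / cmod z * norm x) * q ^ k"
      by (simp only: q_def divide_inverse power_mult_distrib power_Suc ac_simps)
    finally show ?thesis .
  qed
  have geo: "summable (\<lambda>k. (C / cmod z * norm x) * q ^ k)" for x :: 'a
    using q by (intro summable_mult summable_geometric) simp
  have summ_norm: "summable (\<lambda>k. norm (s x k))" if "x \<in> M" for x
    by (rule summable_comparison_test'[OF geo[of x], of 0]) (unfold real_norm_def abs_norm_cancel, rule s_le[OF that])
  then have summ: "summable (s x)" if "x \<in> M" for x
    using summable_norm_cancel[of "s x"] that by simp
  have S_in: "S x \<in> M" if "x \<in> M" for x
  proof (rule closed_sequentially[OF M(2), of "\<lambda>n. \<Sum>k<n. s x k"])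
    show "(\<Sum>k<n. s x k) \<in> M" for n
      by (rule subspace_sum[OF csubspace_imp_subspace[OF M(1)]])
        (use M(1) funpow_closed[OF inv that] in \<open>auto simp: s_def csubspace_def\<close>)
    show "(\<lambda>n. \<Sum>k<n. s x k) \<longlonglongrightarrow> S x"
      unfolding S_def by (rule summable_LIMSEQ[OF summ[OF that]])
  qed
  have S_add: "S (x + y) = S x + S y" if "x \<in> M" "y \<in> M" for x y
  proof -
    have "s (x + y) = (\<lambda>k. s x k + s y k)"
      using Tk by (auto simp: s_def bounded_operator_on_def scaleC_add_right)
    then show ?thesis unfolding S_def using suminf_add[OF summ[OF that(1)] summ[OF that(2)]] by simp
  qed
  have S_C: "S (c *\<^sub>C x) = c *\<^sub>C S x" if "x \<in> M" for c x
  proof -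
    have "s (c *\<^sub>C x) = (\<lambda>k. c *\<^sub>C s x k)"
      using Tk by (auto simp: s_def bounded_operator_on_def scaleC_scaleC mult.commute)
    then show ?thesis unfolding S_def
      using bounded_linear.suminf[OF bounded_linear_scaleC summ[OF that], of c] by simp
  qed
  have S_bound: "norm (S x) \<le> (C / cmod z * (1 / (1 - q))) * norm x" if "x \<in> M" for x
  proof -
    have "norm (S x) \<le> (\<Sum>k. norm (s x k))"
      unfolding S_def by (rule summable_norm[OF summ_norm[OF that]])
    also have "\<dots> \<le> (\<Sum>k. (C / cmod z * norm x) * q ^ k)"
      by (rule suminf_le[OF s_le[OF that] summ_norm[OF that] geo])
    also have "\<dots> = (C / cmod z * norm x) * (1 / (1 - q))"
      using q by (subst suminf_mult) (auto simp: suminf_geometric summable_geometric)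
    finally show ?thesis by (simp add: mult.commute mult.left_commute)
  qed
  have zS: "z *\<^sub>C S x = x + T (S x)" and ST: "S (T x) = T (S x)" if "x \<in> M" for x
  proof -
    have TS: "T (S x) = (\<Sum>k. T (s x k))"
      unfolding S_def by (rule T.suminf[OF summ[OF that]])
    have "s (T x) = (\<lambda>k. T (s x k))"
      by (auto simp: s_def TC funpow_swap1)
    then show "S (T x) = T (S x)" unfolding TS by (simp add: S_def)
    \<comment> \<open>Multiplication by \<open>z\<close> turns term \<open>k + 1\<close> into
      \<open>T\<close> of term \<open>k\<close>; only the leading term \<open>x\<close> is left
      over.\<close>
    have zs: "z *\<^sub>C s x (Suc k) = T (s x k)" for k
      using \<open>z \<noteq> 0\<close> by (simp add: s_def TC scaleC_scaleC mult.assoc[symmetric])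
    have "z *\<^sub>C S x = (\<Sum>k. z *\<^sub>C s x k)"
      unfolding S_def by (rule bounded_linear.suminf[OF bounded_linear_scaleC[of z] summ[OF that]])
    also have "\<dots> = (\<Sum>k. z *\<^sub>C s x (Suc k)) + z *\<^sub>C s x 0"
      using suminf_split_head[OF bounded_linear.summable[OF bounded_linear_scaleC[of z] summ[OF that]]] by simp
    also have "\<dots> = T (S x) + x"
      using \<open>z \<noteq> 0\<close> unfolding zs TS by (simp add: s_def scaleC_scaleC)
    finally show "z *\<^sub>C S x = x + T (S x)" by simp
  qed
  have "bounded_operator_on M S"
    unfolding bounded_operator_on_def
    by (intro conjI ballI allI exI[where x="C / cmod z * (1 / (1 - q))"] S_in S_add S_C S_bound)
  moreover have "S (z *\<^sub>C x - T x) = x \<and> z *\<^sub>C S x - T (S x) = x" if x: "x \<in> M" for x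
  proof -
    have mem: "z *\<^sub>C x \<in> M" "T x \<in> M" "(- 1) *\<^sub>C T x \<in> M"
      using M(1) inv x by (auto simp: csubspace_def)
    have "S (z *\<^sub>C x - T x) = S (z *\<^sub>C x + (- 1) *\<^sub>C T x)"
      by (simp add: scaleC_minus_left)
    also have "\<dots> = z *\<^sub>C S x - S (T x)"
      using S_add[OF mem(1,3)] S_C[OF x] S_C[OF mem(2), of "- 1"] by (simp add: scaleC_minus_left)
    finally show ?thesis using zS[OF x] ST[OF x] by simp
  qed
  ultimately show ?thesis by (auto simp: spectrum_on_def)
qed

text \<open>The growth of powers confines the spectrum on \<open>M\<close> to the disc of radius
  \<open>r\<close>; normaloidity passes this bound from the spectral radius to the norm, without the
  constant that the growth bound carries.\<close>

lemma normaloid_on_norm_le: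
  fixes T :: "'a::chilbert_space \<Rightarrow> 'a"
  assumes T: "bounded_operator T" and M: "csubspace M" "closed M" and inv: "T ` M \<subseteq> M"
    and normaloid: "normaloid_on M T" and "n \<ge> 1" and "r > 0"
    and pow: "\<And>x. x \<in> M \<Longrightarrow> norm ((T ^^ n) x) \<le> r ^ n * norm x"
    and "x \<in> M"
  shows "norm (T x) \<le> r * norm x"
proof -
  interpret T: bounded_linear T using T by (simp add: bounded_operator_iff)
  obtain B where B: "B > 0" "\<And>x. norm (T x) \<le> norm x * B" using T.pos_bounded by blast
  obtain C where "\<And>k x. x \<in> M \<Longrightarrow> norm ((T ^^ k) x) \<le> C * r ^ k * norm x"
    using power_bound_imp_growth_bound[OF T inv \<open>n \<ge> 1\<close> \<open>r > 0\<close> pow] by metis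
  then have "cmod z \<le> r" if "z \<in> spectrum_on M T" for z
    using growth_bound_notin_spectrum_on[OF T M inv \<open>r > 0\<close>] that not_le by metis
  then have "spectral_radius_on M T \<le> r"
    unfolding spectral_radius_on_def using \<open>r > 0\<close> by (intro cSup_least) auto
  \<comment> \<open>The quotients are bounded by \<open>B\<close>, so the supremum is a genuine
    upper bound; at the zero vector the quotient is 0.\<close>
  moreover have "norm (T x) / norm x \<le> onorm_on M T"
    unfolding onorm_on_def
  proof (rule cSUP_upper[OF \<open>x \<in> M\<close> bdd_aboveI2])
    show "norm (T y) / norm y \<le> B" for y
      using B by (cases "y = 0") (auto simp: divide_le_eq mult.commute)
  qed
  ultimately have "norm (T x) / norm x \<le> r"
    using normaloid by (simp add: normaloid_on_def)
  then show ?thesis by (cases "x = 0") (auto simp: T.zero divide_le_eq)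
qed

text \<open>Polarising the norm identity equates the real parts of \<open>cinner (T x) (T y)\<close>
  and \<open>cinner (T' x) (T' y)\<close>. Real parts suffice, since \<open>cinner d d\<close> for
  the commutator value \<open>d\<close> is a difference of two such terms.\<close>

lemma normal_operatorI:
  fixes T :: "'a::chilbert_space \<Rightarrow> 'a"
  assumes T: "adjoint_pair T T'" and norm_eq: "\<And>x. norm (T x) = norm (T' x)"
  shows "normal_operator T"
proof -
  have adj: "cinner (T x) y = cinner x (T' y)" "cinner (T' x) y = cinner x (T y)" for x y
    using T adjoint_pair_sym[OF T] by (auto simp: adjoint_pair_def)
  have add: "T (x + y) = T x + T y" "T' (x + y) = T' x + T' y" for x y
    using T by (auto simp: adjoint_pair_def bounded_operator_on_def)
  have Re_eq: "Re (cinner (T x) (T y)) = Re (cinner (T' x) (T' y))" for x y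
    using norm_add_sq[of "T x" "T y"] norm_add_sq[of "T' x" "T' y"] norm_eq[of "x + y"]
    by (simp add: add norm_eq)
  have "T' (T x) = T (T' x)" for x
  proof -
    define d where "d = T' (T x) - T (T' x)"
    have "cinner d d = cinner (T x) (T d) - cinner (T' x) (T' d)"
      by (subst d_def) (simp add: cinner_diff_left adj)
    then have "(norm d)\<^sup>2 = 0" using Re_eq[of x d] Re_cinner_self[of d] by simp
    then show ?thesis by (simp add: d_def)
  qed
  then show ?thesis
    unfolding normal_operator_def cadjoint_unique[OF T] by auto
qed

subsection \<open>Roots of normal operators\<close>

text \<open>The last \<open>n - 1\<close> applications of \<open>U\<close> gain at most a factor
  \<open>b\<close> each, so the first one must already contribute
  \<open>(c * b) ^ n / b ^ (n - 1) = c ^ n * b\<close>.\<close>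

lemma norm_lower_bound_from_power:
  fixes U :: "'a::real_normed_vector \<Rightarrow> 'a"
  assumes inv: "U ` M \<subseteq> M" and le: "\<And>x. x \<in> M \<Longrightarrow> norm (U x) \<le> b * norm x" and "b > 0" "n \<ge> 1"
    and "q \<in> M" and lower: "(c * b) ^ n * norm q \<le> norm ((U ^^ n) q)"
  shows "c ^ n * b * norm q \<le> norm (U q)"
proof -
  obtain m where n: "n = Suc m" using \<open>n \<ge> 1\<close> by (cases n) auto
  have "U q \<in> M" using inv \<open>q \<in> M\<close> by auto
  then have "norm ((U ^^ m) (U q)) \<le> b ^ m * norm (U q)"
    using \<open>b > 0\<close> by (intro norm_funpow_le[OF inv le]) auto
  then have "(c * b) ^ n * norm q \<le> b ^ m * norm (U q)"
    using lower by (simp add: n funpow_swap1)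
  moreover have "(c * b) ^ n * norm q = b ^ m * (c ^ n * b * norm q)"
    by (simp add: n power_mult_distrib ac_simps)
  ultimately show ?thesis using \<open>b > 0\<close> by simp
qed

locale normaloid_root_of_normal =
  fixes T :: "'a::chilbert_space \<Rightarrow> 'a" and n :: nat
  assumes T: "bounded_operator T" and normaloid: "completely_normaloid T"
    and n: "n \<ge> 1" and normal: "normal_operator (T ^^ n)"
begin

abbreviation "T' \<equiv> cadjoint T"

lemmas pair_T = adjoint_pair_cadjoint[OF T]

lemma bounded_T': "bounded_operator T'"
  using pair_T by (simp add: adjoint_pair_def)

text \<open>For positive \<open>r\<close> the division by \<open>r ^ n\<close> moves the disc of
  radius \<open>r ^ n\<close> to the unit disc. The operator is a parameter so that
  \<open>T'\<close> is scaled in the same way.\<close>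

definition scaled :: "('a \<Rightarrow> 'a) \<Rightarrow> real \<Rightarrow> 'a \<Rightarrow> 'a" where
  "scaled U r x = (1 / r ^ n) *\<^sub>R (U ^^ n) x"

definition M :: "real \<Rightarrow> 'a set" where
  "M r = power_contractive (scaled T r)"

lemma normal_pair_scaled: "normal_pair (scaled T r) (scaled T' r)"
proof
  show pair: "adjoint_pair (scaled T r) (scaled T' r)"
    unfolding scaled_def[abs_def] by (intro adjoint_pair_scaleR adjoint_pair_funpow pair_T)
  have "cadjoint (T ^^ n) = T' ^^ n"
    by (rule cadjoint_unique[OF adjoint_pair_funpow[OF pair_T]])
  then have "(T ^^ n) ((T' ^^ n) x) = (T' ^^ n) ((T ^^ n) x)" for x
    using normal by (metis normal_operator_def comp_apply)
  moreover have "(U ^^ n) (c *\<^sub>R x) = c *\<^sub>R (U ^^ n) x" if "bounded_operator U" for U :: "'a \<Rightarrow> 'a" and c x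
    using bounded_operator_funpow[OF that] by (rule bounded_operator_apply_scaleR)
  ultimately show "scaled T r (scaled T' r x) = scaled T' r (scaled T r x)" for x
    by (simp add: scaled_def T bounded_T')
qed

lemma scaled_commute: "bounded_operator U \<Longrightarrow> U (scaled U r x) = scaled U r (U x)"
  by (simp add: scaled_def bounded_operator_apply_scaleR funpow_swap1)

text \<open>\<open>T\<close> commutes with its own scaled power and \<open>T'\<close> with its own,
  which are the two alternatives in \<open>power_contractive_invariant\<close>.\<close>

lemma reduces_M: "reduces (M r) T"
proof -
  interpret normal_pair "scaled T r" "scaled T' r" by (rule normal_pair_scaled)
  have "U x \<in> M r"
    if "x \<in> M r" and U: "bounded_operator U" and "U = T \<or> U = T'" for x U
    unfolding M_def
  proof (rule power_contractive_invariant[of U x])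
    show "bounded_linear U" using U by (simp add: bounded_operator_iff)
    show "(\<forall>x. U (scaled T r x) = scaled T r (U x)) \<or> (\<forall>x. U (scaled T' r x) = scaled T' r (U x))"
      using scaled_commute[OF U] \<open>U = T \<or> U = T'\<close> by blast
    show "x \<in> power_contractive (scaled T r)" using \<open>x \<in> M r\<close> by (simp add: M_def)
  qed
  then have "T ` M r \<subseteq> M r" "T' ` M r \<subseteq> M r"
    using T bounded_T' by blast+
  then show ?thesis
    using csubspace_power_contractive closed_power_contractive by (simp add: reduces_def M_def)
qed

lemma M_properties: "csubspace (M r)" "closed (M r)" "T ` M r \<subseteq> M r" "T' ` M r \<subseteq> M r"
  using reduces_M[of r] by (auto simp: reduces_def)

text \<open>Complete normaloidity enters here, through the reducing subspace \<open>M r\<close>: the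
  case of exponent 1 in power contractivity bounds \<open>T ^^ n\<close> by \<open>r ^ n\<close>,
  and this descends to \<open>T\<close>.\<close>

lemma norm_T_le:
  assumes "r > 0" "x \<in> M r"
  shows "norm (T x) \<le> r * norm x"
proof (rule normaloid_on_norm_le[OF T M_properties(1-3) _ n \<open>r > 0\<close> _ \<open>x \<in> M r\<close>])
  show "normaloid_on (M r) T"
    using normaloid reduces_M by (simp add: completely_normaloid_def)
  fix y assume "y \<in> M r"
  then have "norm ((scaled T r ^^ 1) y) \<le> norm y" unfolding M_def power_contractive_def by blast
  then show "norm ((T ^^ n) y) \<le> r ^ n * norm y"
    using \<open>r > 0\<close> by (simp add: scaled_def divide_le_eq mult.commute)
qed

text \<open>As \<open>M r\<close> is invariant under \<open>T'\<close>, the bound for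
  \<open>T\<close> applies to \<open>T' x\<close> in \<open>cinner (T (T' x)) x\<close>.\<close>

lemma norm_T'_le:
  assumes "r > 0" "x \<in> M r"
  shows "norm (T' x) \<le> r * norm x"
proof (cases "T' x = 0")
  case False
  have "T' x \<in> M r" using M_properties(4) \<open>x \<in> M r\<close> by blast
  have "(norm (T' x))\<^sup>2 = Re (cinner (T (T' x)) x)"
    using pair_T by (simp add: adjoint_pair_def cinner_self)
  also have "\<dots> \<le> norm (T (T' x)) * norm x" by (rule Re_cinner_le)
  also have "\<dots> \<le> (r * norm (T' x)) * norm x"
    using norm_T_le[OF \<open>r > 0\<close> \<open>T' x \<in> M r\<close>] by (rule mult_right_mono) simp
  finally have "norm (T' x) * norm (T' x) \<le> norm (T' x) * (r * norm x)"
    by (simp add: power2_eq_square ac_simps)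
  then show ?thesis using False by simp
qed (use \<open>r > 0\<close> in simp)

lemma norm_power_ge:
  assumes "r > 0" "orthogonal_to (M r) x"
  shows "r ^ n * norm x \<le> norm ((T ^^ n) x)" "r ^ n * norm x \<le> norm ((T' ^^ n) x)"
proof -
  interpret normal_pair "scaled T r" "scaled T' r" by (rule normal_pair_scaled)
  have "norm x \<le> norm (scaled T r x)" using norm_le_if_orthogonal assms(2) by (simp add: M_def)
  then show "r ^ n * norm x \<le> norm ((T ^^ n) x)" "r ^ n * norm x \<le> norm ((T' ^^ n) x)"
    using norm_adjoint[of x] \<open>r > 0\<close> by (simp_all add: scaled_def le_divide_eq mult.commute)
qed

lemma M_mono:
  assumes "0 < a" "a \<le> b"
  shows "M a \<subseteq> M b"
proof
  fix x assume x: "x \<in> M a"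
  have TN: "(T ^^ n) (c *\<^sub>R x) = c *\<^sub>R (T ^^ n) x" for c x
    using bounded_operator_funpow[OF T] by (rule bounded_operator_apply_scaleR)
  have pow: "(scaled T r ^^ k) x = (1 / r ^ n) ^ k *\<^sub>R ((T ^^ n) ^^ k) x" for r k
    by (induction k) (auto simp: scaled_def TN)
  have "norm ((scaled T b ^^ k) x) \<le> norm ((scaled T a ^^ k) x)" for k
    unfolding pow using assms
    by (auto intro!: mult_right_mono power_mono divide_left_mono simp: power_mono simp del: power_one_over)
  then show "x \<in> M b"
    using x unfolding M_def power_contractive_def by (blast intro: order_trans)
qed

lemma M_eq_UNIV:
  assumes "r > 0" and le: "\<And>x. norm (T x) \<le> r * norm x"
  shows "M r = UNIV"
proof -
  have "norm ((T ^^ n) x) \<le> r ^ n * norm x" for x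
    using assms by (intro norm_funpow_le[where M=UNIV]) auto
  then have "norm (scaled T r x) \<le> 1 * norm x" for x
    using \<open>r > 0\<close> by (simp add: scaled_def divide_le_eq mult.commute)
  then have "norm ((scaled T r ^^ k) x) \<le> 1 ^ k * norm x" for k x
    by (intro norm_funpow_le[where M=UNIV]) auto
  then show ?thesis by (auto simp: M_def power_contractive_def)
qed

text \<open>Both squared norms lie between \<open>c ^ (2 * n)\<close> and 1 times
  \<open>b\<^sup>2 * (norm q)\<^sup>2\<close>: above because \<open>q\<close> is in
  \<open>M b\<close>, below because it is orthogonal to \<open>M (c * b)\<close>.\<close>

lemma norm_diff_on_annulus:
  assumes "b > 0" "0 < c" "c \<le> 1" and q: "q \<in> M b" "orthogonal_to (M (c * b)) q"
  shows "\<bar>(norm (T q))\<^sup>2 - (norm (T' q))\<^sup>2\<bar> \<le> (1 - c ^ (2 * n)) * b\<^sup>2 * (norm q)\<^sup>2"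
proof -
  have "c * b > 0" using assms by simp
  have lower: "c ^ n * b * norm q \<le> norm (T q)" "c ^ n * b * norm q \<le> norm (T' q)"
    using norm_lower_bound_from_power[OF M_properties(3) norm_T_le[OF \<open>b > 0\<close>] \<open>b > 0\<close> n q(1)]
      norm_lower_bound_from_power[OF M_properties(4) norm_T'_le[OF \<open>b > 0\<close>] \<open>b > 0\<close> n q(1)]
      norm_power_ge[OF \<open>c * b > 0\<close> q(2)] by blast+
  have bounds: "c ^ (2 * n) * b\<^sup>2 * (norm q)\<^sup>2 \<le> t\<^sup>2 \<and> t\<^sup>2 \<le> b\<^sup>2 * (norm q)\<^sup>2"
    if "c ^ n * b * norm q \<le> t" "t \<le> b * norm q" for t
  proof -
    have "0 \<le> c ^ n * b * norm q" using \<open>b > 0\<close> \<open>0 < c\<close> by simp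
    then have "(c ^ n * b * norm q)\<^sup>2 \<le> t\<^sup>2" "t\<^sup>2 \<le> (b * norm q)\<^sup>2"
      using that by (auto intro: power_mono)
    then show ?thesis by (simp add: power_mult_distrib power_mult[symmetric] mult.commute)
  qed
  show ?thesis
    using bounds[OF lower(1) norm_T_le[OF \<open>b > 0\<close> q(1)]] bounds[OF lower(2) norm_T'_le[OF \<open>b > 0\<close> q(1)]]
    unfolding left_diff_distrib by linarith
qed

text \<open>One annulus is split off. The estimates for the two components add without loss, since
  \<open>T\<close> and \<open>T'\<close> preserve their orthogonality.\<close>

lemma norm_diff_step:
  assumes "b > 0" "0 < c" "c \<le> 1" and e: "(1 - c ^ (2 * n)) * b\<^sup>2 \<le> e"
    and IH: "\<And>x. x \<in> M (c * b) \<Longrightarrow> \<bar>(norm (T x))\<^sup>2 - (norm (T' x))\<^sup>2\<bar> \<le> e * (norm x)\<^sup>2"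
    and x: "x \<in> M b"
  shows "\<bar>(norm (T x))\<^sup>2 - (norm (T' x))\<^sup>2\<bar> \<le> e * (norm x)\<^sup>2"
proof -
  let ?L = "M (c * b)"
  obtain p q where pq: "x = p + q" "p \<in> ?L" "orthogonal_to ?L q"
    by (rule closed_csubspace_decomposition[OF M_properties(1,2)])
  have "p \<in> M b" using pq(2) M_mono[of "c * b" b] assms(1-3) by (auto simp: mult_le_cancel_right1)
  then have "q \<in> M b"
    using subspace_diff[OF csubspace_imp_subspace[OF M_properties(1)] x, of p] by (simp add: pq(1))
  \<comment> \<open>Moving one operator across leaves \<open>q\<close> paired with
    \<open>T' (T p)\<close> or \<open>T (T' p)\<close>, which stay in the reducing subspace
    containing \<open>p\<close>.\<close>
  have "cinner (T p) (T q) = cinner (T' (T p)) q" "cinner (T' p) (T' q) = cinner (T (T' p)) q"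
    using pair_T adjoint_pair_sym[OF pair_T] by (simp_all add: adjoint_pair_def)
  moreover have "T' (T p) \<in> ?L" "T (T' p) \<in> ?L"
    using pq(2) M_properties(3,4) by blast+
  ultimately have orth: "cinner (T p) (T q) = 0" "cinner (T' p) (T' q) = 0" "cinner p q = 0"
    using pq(2,3) by (auto simp: orthogonal_to_def)
  have add: "T x = T p + T q" "T' x = T' p + T' q"
    using T bounded_T' by (auto simp: pq(1) bounded_operator_on_def)
  have norms: "(norm (T x))\<^sup>2 = (norm (T p))\<^sup>2 + (norm (T q))\<^sup>2"
    "(norm (T' x))\<^sup>2 = (norm (T' p))\<^sup>2 + (norm (T' q))\<^sup>2" "(norm x)\<^sup>2 = (norm p)\<^sup>2 + (norm q)\<^sup>2"
    unfolding add by (simp_all add: norm_add_sq orth pq(1))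
  have "\<bar>(norm (T q))\<^sup>2 - (norm (T' q))\<^sup>2\<bar> \<le> e * (norm q)\<^sup>2"
    using norm_diff_on_annulus[OF assms(1-3) \<open>q \<in> M b\<close> pq(3)] mult_right_mono[OF e, of "(norm q)\<^sup>2"]
    by simp
  then show ?thesis
    using IH[OF pq(2)] unfolding norms distrib_left by linarith
qed

text \<open>Radii shrink geometrically from a norm bound \<open>R\<close>. Each annulus costs at
  most \<open>e\<close>, and because the pieces are orthogonal the costs do not accumulate with
  their number.\<close>

lemma norm_diff_le:
  assumes "e > 0"
  shows "\<bar>(norm (T x))\<^sup>2 - (norm (T' x))\<^sup>2\<bar> \<le> e * (norm x)\<^sup>2"
proof -
  obtain R where R: "R > 0" "\<And>x. norm (T x) \<le> norm x * R"
    using bounded_linear.pos_bounded[of T] T by (auto simp: bounded_operator_iff)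
  \<comment> \<open>By Bernoulli, \<open>1 - (1 - d) ^ (2 * n) \<le> 2 * n * d\<close>, which the
    second bound keeps below \<open>e / R\<^sup>2\<close>; the first keeps \<open>c\<close>
    positive.\<close>
  define d where "d = min (1 / 2) (e / (2 * n * R\<^sup>2))"
  define c where "c = 1 - d"
  have d: "0 < d" "d \<le> 1 / 2" using \<open>e > 0\<close> R(1) n by (auto simp: d_def)
  then have c: "0 < c" "c \<le> 1" "c < 1" by (auto simp: c_def)
  have "1 - c ^ (2 * n) \<le> 2 * n * d"
    using Bernoulli_inequality[of "- d" "2 * n"] d by (simp add: c_def)
  also have "\<dots> \<le> 2 * n * (e / (2 * n * R\<^sup>2))"
    by (intro mult_left_mono) (auto simp: d_def)
  also have "\<dots> = e / R\<^sup>2" using n by simp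
  finally have ce: "(1 - c ^ (2 * n)) * R\<^sup>2 \<le> e" using R(1) by (simp add: le_divide_eq)
  \<comment> \<open>After \<open>m\<close> contractions the radius is below \<open>sqrt e\<close>,
    so both squared norms are at most \<open>e * (norm x)\<^sup>2\<close> and no lower bound is
    called for.\<close>
  obtain m where m: "c ^ m < sqrt e / R"
    using real_arch_pow_inv[of "sqrt e / R" c] c \<open>e > 0\<close> R(1) by auto
  have start: "\<bar>(norm (T x))\<^sup>2 - (norm (T' x))\<^sup>2\<bar> \<le> e * (norm x)\<^sup>2" if x: "x \<in> M (c ^ m * R)" for x
  proof -
    have r: "c ^ m * R > 0" using c R(1) by simp
    have "c ^ m * R \<le> sqrt e" using m R(1) by (simp add: less_divide_eq)
    then have le: "(c ^ m * R * norm x)\<^sup>2 \<le> e * (norm x)\<^sup>2"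
      using power_mono[of "c ^ m * R" "sqrt e" 2] r \<open>e > 0\<close> by (simp add: power_mult_distrib mult_right_mono)
    have "(norm (T x))\<^sup>2 \<le> (c ^ m * R * norm x)\<^sup>2" "(norm (T' x))\<^sup>2 \<le> (c ^ m * R * norm x)\<^sup>2"
      using norm_T_le[OF r x] norm_T'_le[OF r x] by (auto intro: power_mono)
    then show ?thesis
      using le zero_le_power2[of "norm (T x)"] zero_le_power2[of "norm (T' x)"] by linarith
  qed
  \<comment> \<open>The induction descends from the small radius at \<open>m\<close> to
    \<open>k = 0\<close>, where \<open>M R\<close> is the whole space.\<close>
  have "k \<le> m \<Longrightarrow> \<forall>x\<in>M (c ^ k * R). \<bar>(norm (T x))\<^sup>2 - (norm (T' x))\<^sup>2\<bar> \<le> e * (norm x)\<^sup>2" for k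
  proof (induction k rule: inc_induct)
    case base
    then show ?case using start by blast
  next
    case (step k)
    have pos: "c ^ k * R > 0" using c R(1) by simp
    have "(c ^ k * R)\<^sup>2 \<le> R\<^sup>2"
      using c R(1) pos by (intro power_mono) (auto simp: mult_le_cancel_right1 power_le_one)
    then have "(1 - c ^ (2 * n)) * (c ^ k * R)\<^sup>2 \<le> (1 - c ^ (2 * n)) * R\<^sup>2"
      using c by (intro mult_left_mono) (auto simp: power_le_one)
    then have "(1 - c ^ (2 * n)) * (c ^ k * R)\<^sup>2 \<le> e" using ce by linarith
    then show ?case
      using norm_diff_step[OF pos c(1,2)] step.IH by (simp add: mult.assoc)
  qed
  from this[of 0] show ?thesis
    using M_eq_UNIV[OF R(1)] R(2) by (simp add: mult.commute)
qed

lemma normal_operator_root: "normal_operator T"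
proof (rule normal_operatorI[OF pair_T])
  fix x
  have "\<bar>(norm (T x))\<^sup>2 - (norm (T' x))\<^sup>2\<bar> \<le> 0"
  proof (rule field_le_epsilon)
    fix e :: real assume "e > 0"
    \<comment> \<open>The summand 1 keeps the chosen tolerance well defined at the zero
      vector.\<close>
    have "\<bar>(norm (T x))\<^sup>2 - (norm (T' x))\<^sup>2\<bar> \<le> e / (1 + (norm x)\<^sup>2) * (norm x)\<^sup>2"
      using \<open>e > 0\<close> by (intro norm_diff_le) (simp add: add_pos_nonneg)
    also have "\<dots> \<le> e" using \<open>e > 0\<close> by (simp add: divide_le_eq add_pos_nonneg)
    finally show "\<bar>(norm (T x))\<^sup>2 - (norm (T' x))\<^sup>2\<bar> \<le> 0 + e" by simp
  qed
  then show "norm (T x) = norm (T' x)" by (simp add: power2_eq_iff_nonneg)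
qed

end

theorem theorem6p1:
  fixes T :: "'a::chilbert_space \<Rightarrow> 'a" and n :: nat
  assumes "bounded_operator T"
    and "completely_normaloid T"
    and "n \<ge> 1"
    and "normal_operator (T ^^ n)"
  shows "normal_operator T"
  using normaloid_root_of_normal.normal_operator_root[of T n] assms
  by (simp add: normaloid_root_of_normal_def)

end
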